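(* Let $\mathfrak h$ be a topological Lie algebra, $V$ a topological $\mathfrak h$-module and $\omega\in C^2(\mathfrak h,V)$ a continuous $2$-cochain. (i) The space $V_\omega$ of admissible vectors carries a Lie algebra structure defined by $$\{v_1,v_2\}:=\xi_1.v_2=-\xi_2.v_1=-\omega(\xi_1,\xi_2)\quad\text{for } d_{\mathfrak h}v_j=i_{\xi_j}\omega,\ \xi_j\in\mathrm{ham}(\mathfrak h,\omega),\ j=1,2,$$ and for which $V^{\mathfrak h}$ is central. With the quotient Lie algebra structure on $d_{\mathfrak h}(V_\omega)\cong V_\omega/V^{\mathfrak h}$ and $q(\xi)=i_\xi\omega$, one has the exact sequence of Lie algebras $$0\to\mathrm{rad}(\omega,d_{\mathfrak h}\omega)\to\mathrm{ham}(\mathfrak h,\omega)\xrightarrow{\ q\ }d_{\mathfrak h}(V_\omega)\to 0.$$ (ii) Let $\mathfrak h_\omega:=\{\xi\in\mathfrak h: i_\xi d_{\mathfrak h}\omega=0,\ [\xi,\mathrm{rad}(\omega,d_{\mathfrak h}\omega)]\subseteq\mathrm{rad}(\omega,d_{\mathfrak h}\omega)\}$. Then $\mathrm{sp}(\mathfrak h,\omega)\subseteq\mathfrak h_\omega$, and the set $$C^1(\mathfrak h,V)_\omega:=\{i_\xi\omega:\xi\in\mathfrak h_\omega\}\subseteq C^1(\mathfrak h,V)$$ inherits a Lie algebra structure defined by $[i_{\xi_1}\omega,i_{\xi_2}\omega]:=i_{[\xi_1,\xi_2]}\omega$. For $\alpha_j=i_{\xi_j}\omega$ with $\xi_j\in\mathfrak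 h_\omega$, $j=1,2$, we then have $$[\alpha_1,\alpha_2]=\mathcal L_{\xi_1}\alpha_2-i_{\xi_2}\mathcal L_{\xi_1}\omega.$$ The maps $$i^\omega:\mathfrak h_\omega\to C^1(\mathfrak h,V)_\omega,\ \xi\mapsto i_\xi\omega\qquad\text{and}\qquad d_{\mathfrak h}:V_\omega\to C^1(\mathfrak h,V)_\omega,\ v\mapsto d_{\mathfrak h}v$$ are homomorphisms of Lie algebras. In particular, $$0\to\mathrm{rad}(\omega,d_{\mathfrak h}\omega)\to\mathfrak h_\omega\xrightarrow{\ i^\omega\ }C^1(\mathfrak h,V)_\omega\to 0$$ is an exact sequence of Lie algebras extending the exact sequence in (i).
   Context: $(C^\bullet(\mathfrak h,V),d_{\mathfrak h})$ is the Chevalley–Eilenberg complex of continuous cochains: $(d_{\mathfrak h}v)(\xi)=\xi.v$, $(d_{\mathfrak h}\alpha)(\xi,\eta)=\xi.\alpha(\eta)-\eta.\alpha(\xi)-\alpha([\xi,\eta])$, $(d_{\mathfrak h}\omega)(\xi,\eta,\nu)=\sum_{\rm cycl.}\xi.\omega(\eta,\nu)-\sum_{\rm cycl.}\omega([\xi,\eta],\nu)$. $i_\xi$ is insertion of $\xi$ in the first argument, and $\mathcal L_\xi$ is the natural action of $\xi\in\mathfrak h$ on cochains, e.g. $(\mathcal L_\xi\omega)(\eta,\nu)=\xi.\omega(\eta,\nu)-\omega([\xi,\eta],\nu)-\omega(\eta,[\xi,\nu])$. $\mathrm{sp}(\mathfrak h,\omega)=\{\xi\in\mathfrak h:\mathcal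 L_\xi\omega=0,\ i_\xi d_{\mathfrak h}\omega=0\}$ (a Lie subalgebra of $\mathfrak h$); $\mathrm{ham}(\mathfrak h,\omega)=\{\xi\in\mathrm{sp}(\mathfrak h,\omega):(\exists v\in V)\ i_\xi\omega=d_{\mathfrak h}v\}$ (an ideal of it); the space of admissible vectors is $V_\omega=\{v\in V:(\exists\xi\in\mathrm{ham}(\mathfrak h,\omega))\ d_{\mathfrak h}v=i_\xi\omega\}$; $V^{\mathfrak h}=\{v\in V:(\forall\xi\in\mathfrak h)\ \xi.v=0\}$; $\mathrm{rad}(\omega,d_{\mathfrak h}\omega)=\{\xi\in\mathfrak h:i_\xi\omega=0,\ i_\xi d_{\mathfrak h}\omega=0\}$. "Extending" means that $\mathrm{ham}(\mathfrak h,\omega)\subseteq\mathfrak h_\omega$, $d_{\mathfrak h}(V_\omega)\subseteq C^1(\mathfrak h,V)_\omega$ as Lie algebras, and $i^\omega$ restricts to $q$ on $\mathrm{ham}(\mathfrak h,\omega)$. *)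

theory Defs
  imports Complex_Main "HOL-Library.FuncSet" "HOL-Library.Function_Algebras"
begin

section \<open>Lie algebras on a carrier\<close>

text \<open>
  Most Lie algebras below are subspaces of an ambient vector space, but the quotient by an ideal
  consists of cosets. Carrier and operations are therefore kept in one record.
\<close>

record ('k, 'a) lie_alg =
  lcarrier :: "'a set"
  lzero :: 'a
  ladd :: "'a \<Rightarrow> 'a \<Rightarrow> 'a"
  lscale :: "'k \<Rightarrow> 'a \<Rightarrow> 'a"
  lbracket :: "'a \<Rightarrow> 'a \<Rightarrow> 'a"

locale lie_algebra =
  fixes L :: "('k::field, 'a) lie_alg"
  assumes zero_closed: "lzero L \<in> lcarrier L"
    and add_closed: "\<lbrakk>x \<in> lcarrier L; y \<in> lcarrier L\<rbrakk> \<Longrightarrow> ladd L x y \<in> lcarrier L"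
    and add_assoc: "\<lbrakk>x \<in> lcarrier L; y \<in> lcarrier L; z \<in> lcarrier L\<rbrakk>
      \<Longrightarrow> ladd L (ladd L x y) z = ladd L x (ladd L y z)"
    and add_commute: "\<lbrakk>x \<in> lcarrier L; y \<in> lcarrier L\<rbrakk> \<Longrightarrow> ladd L x y = ladd L y x"
    and add_zero: "x \<in> lcarrier L \<Longrightarrow> ladd L (lzero L) x = x"
    and add_inverse: "x \<in> lcarrier L \<Longrightarrow> \<exists>y\<in>lcarrier L. ladd L y x = lzero L"
    and scale_closed: "x \<in> lcarrier L \<Longrightarrow> lscale L c x \<in> lcarrier L"
    and scale_add_right: "\<lbrakk>x \<in> lcarrier L; y \<in> lcarrier L\<rbrakk>
      \<Longrightarrow> lscale L c (ladd L x y) = ladd L (lscale L c x) (lscale L c y)"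
    and scale_add_left: "x \<in> lcarrier L
      \<Longrightarrow> lscale L (c + d) x = ladd L (lscale L c x) (lscale L d x)"
    and scale_scale: "x \<in> lcarrier L \<Longrightarrow> lscale L c (lscale L d x) = lscale L (c * d) x"
    and scale_one: "x \<in> lcarrier L \<Longrightarrow> lscale L 1 x = x"
    and bracket_closed: "\<lbrakk>x \<in> lcarrier L; y \<in> lcarrier L\<rbrakk> \<Longrightarrow> lbracket L x y \<in> lcarrier L"
    and bracket_add_left: "\<lbrakk>x \<in> lcarrier L; y \<in> lcarrier L; z \<in> lcarrier L\<rbrakk>
      \<Longrightarrow> lbracket L (ladd L x y) z = ladd L (lbracket L x z) (lbracket L y z)"
    and bracket_add_right: "\<lbrakk>x \<in> lcarrier L; y \<in> lcarrier L; z \<in> lcarrier L\<rbrakk>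
      \<Longrightarrow> lbracket L x (ladd L y z) = ladd L (lbracket L x y) (lbracket L x z)"
    and bracket_scale_left: "\<lbrakk>x \<in> lcarrier L; y \<in> lcarrier L\<rbrakk>
      \<Longrightarrow> lbracket L (lscale L c x) y = lscale L c (lbracket L x y)"
    and bracket_scale_right: "\<lbrakk>x \<in> lcarrier L; y \<in> lcarrier L\<rbrakk>
      \<Longrightarrow> lbracket L x (lscale L c y) = lscale L c (lbracket L x y)"
    and bracket_self: "x \<in> lcarrier L \<Longrightarrow> lbracket L x x = lzero L"
    and jacobi: "\<lbrakk>x \<in> lcarrier L; y \<in> lcarrier L; z \<in> lcarrier L\<rbrakk>
      \<Longrightarrow> ladd L (lbracket L x (lbracket L y z))
            (ladd L (lbracket L y (lbracket L z x)) (lbracket L z (lbracket L x y))) = lzero L"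

text \<open>The subset \<open>S\<close> of an ambient vector space, with bracket \<open>b\<close>.\<close>

definition lie_on :: "('k \<Rightarrow> 'a \<Rightarrow> 'a) \<Rightarrow> 'a set \<Rightarrow> ('a \<Rightarrow> 'a \<Rightarrow> 'a) \<Rightarrow> ('k, 'a::ab_group_add) lie_alg"
  where "lie_on s S b =
    \<lparr>lcarrier = S, lzero = 0, ladd = (+), lscale = s, lbracket = b\<rparr>"

definition lie_hom :: "('k::field, 'a) lie_alg \<Rightarrow> ('k, 'b) lie_alg \<Rightarrow> ('a \<Rightarrow> 'b) \<Rightarrow> bool" where
  "lie_hom L M f \<longleftrightarrow> lie_algebra L \<and> lie_algebra M \<and> f \<in> lcarrier L \<rightarrow> lcarrier M \<and>
    (\<forall>x\<in>lcarrier L. \<forall>y\<in>lcarrier L. f (ladd L x y) = ladd M (f x) (f y)) \<and>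
    (\<forall>c. \<forall>x\<in>lcarrier L. f (lscale L c x) = lscale M c (f x)) \<and>
    (\<forall>x\<in>lcarrier L. \<forall>y\<in>lcarrier L. f (lbracket L x y) = lbracket M (f x) (f y))"

definition lie_iso :: "('k::field, 'a) lie_alg \<Rightarrow> ('k, 'b) lie_alg \<Rightarrow> ('a \<Rightarrow> 'b) \<Rightarrow> bool" where
  "lie_iso L M f \<longleftrightarrow> lie_hom L M f \<and> bij_betw f (lcarrier L) (lcarrier M)"

definition lie_subalgebra :: "('k::field, 'a) lie_alg \<Rightarrow> ('k, 'a) lie_alg \<Rightarrow> bool" where
  "lie_subalgebra L M \<longleftrightarrow> lcarrier L \<subseteq> lcarrier M \<and> lie_hom L M (\<lambda>x. x)"

definition lie_center :: "('k, 'a) lie_alg \<Rightarrow> 'a set" where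
  "lie_center L = {z \<in> lcarrier L. \<forall>x\<in>lcarrier L. lbracket L z x = lzero L}"

definition lie_coset :: "('k, 'a) lie_alg \<Rightarrow> 'a set \<Rightarrow> 'a \<Rightarrow> 'a set" where
  "lie_coset L I x = ladd L x ` I"

text \<open>The unions run over all representatives; for an ideal \<open>I\<close> all their members coincide.\<close>

definition lie_quotient :: "('k, 'a) lie_alg \<Rightarrow> 'a set \<Rightarrow> ('k, 'a set) lie_alg" where
  "lie_quotient L I =
    \<lparr>lcarrier = lie_coset L I ` lcarrier L,
     lzero = I,
     ladd = (\<lambda>A B. \<Union>a\<in>A. \<Union>b\<in>B. lie_coset L I (ladd L a b)),
     lscale = (\<lambda>c A. \<Union>a\<in>A. lie_coset L I (lscale L c a)),
     lbracket = (\<lambda>A B. \<Union>a\<in>A. \<Union>b\<in>B. lie_coset L I (lbracket L a b))\<rparr>"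

text \<open>Exactness of \<open>0 \<rightarrow> A \<rightarrow> B \<rightarrow> C \<rightarrow> 0\<close> with maps \<open>f\<close> and \<open>g\<close>.\<close>

definition lie_short_exact :: "('k::field, 'a) lie_alg \<Rightarrow> ('a \<Rightarrow> 'b) \<Rightarrow> ('k, 'b) lie_alg
    \<Rightarrow> ('b \<Rightarrow> 'c) \<Rightarrow> ('k, 'c) lie_alg \<Rightarrow> bool" where
  "lie_short_exact A f B g C \<longleftrightarrow> lie_hom A B f \<and> lie_hom B C g \<and>
    inj_on f (lcarrier A) \<and>
    f ` lcarrier A = {x \<in> lcarrier B. g x = lzero C} \<and>
    g ` lcarrier B = lcarrier C"

section \<open>Topological Lie algebras and modules\<close>

text \<open>
  The scalars form a field with continuous ring operations; continuity of the inverse and the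
  Hausdorff property are not required.
\<close>

locale topological_vector_space = vector_space scale
  for scale :: "'k::{field, topological_ab_group_add, topological_semigroup_mult}
    \<Rightarrow> 'a::topological_ab_group_add \<Rightarrow> 'a" +
  assumes continuous_scale: "continuous_on UNIV (\<lambda>(c, x). scale c x)"

locale topological_lie_algebra = topological_vector_space sh
  for sh :: "'k::{field, topological_ab_group_add, topological_semigroup_mult}
    \<Rightarrow> 'h::topological_ab_group_add \<Rightarrow> 'h" +
  fixes br :: "'h \<Rightarrow> 'h \<Rightarrow> 'h"
  assumes lie_algebra: "lie_algebra (lie_on sh UNIV br)"
    and continuous_bracket: "continuous_on UNIV (\<lambda>(\<xi>, \<eta>). br \<xi> \<eta>)"

locale topological_lie_module =
  h: topological_lie_algebra sh br + V: topological_vector_space sv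
  for sh :: "'k::{field, topological_ab_group_add, topological_semigroup_mult}
      \<Rightarrow> 'h::topological_ab_group_add \<Rightarrow> 'h"
    and br :: "'h \<Rightarrow> 'h \<Rightarrow> 'h"
    and sv :: "'k \<Rightarrow> 'v::topological_ab_group_add \<Rightarrow> 'v" +
  fixes act :: "'h \<Rightarrow> 'v \<Rightarrow> 'v"
  assumes linear_act_left: "Vector_Spaces.linear sh sv (\<lambda>\<xi>. act \<xi> v)"
    and linear_act_right: "Vector_Spaces.linear sv sv (act \<xi>)"
    and act_bracket: "act (br \<xi> \<eta>) v = act \<xi> (act \<eta> v) - act \<eta> (act \<xi> v)"
    and continuous_act: "continuous_on UNIV (\<lambda>(\<xi>, v). act \<xi> v)"

section \<open>Cochains\<close>

definition cochains1 :: "('k::field \<Rightarrow> 'h \<Rightarrow> 'h)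
    \<Rightarrow> ('k \<Rightarrow> 'v \<Rightarrow> 'v) \<Rightarrow> ('h::{ab_group_add, topological_space}
    \<Rightarrow> 'v::{ab_group_add, topological_space}) set" where
  "cochains1 sh sv = {\<alpha>. Vector_Spaces.linear sh sv \<alpha> \<and> continuous_on UNIV \<alpha>}"

definition cochains2 :: "('k::field \<Rightarrow> 'h \<Rightarrow> 'h)
    \<Rightarrow> ('k \<Rightarrow> 'v \<Rightarrow> 'v) \<Rightarrow> ('h::{ab_group_add, topological_space} \<Rightarrow> 'h
    \<Rightarrow> 'v::{ab_group_add, topological_space}) set" where
  "cochains2 sh sv = {\<omega>. (\<forall>\<xi>. Vector_Spaces.linear sh sv (\<omega> \<xi>)) \<and>
    (\<forall>\<eta>. Vector_Spaces.linear sh sv (\<lambda>\<xi>. \<omega> \<xi> \<eta>)) \<and> (\<forall>\<xi>. \<omega> \<xi> \<xi> = 0) \<and>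
    continuous_on UNIV (\<lambda>(\<xi>, \<eta>). \<omega> \<xi> \<eta>)}"

definition cochain_scale :: "('k \<Rightarrow> 'v \<Rightarrow> 'v) \<Rightarrow> 'k \<Rightarrow> ('h \<Rightarrow> 'v) \<Rightarrow> 'h \<Rightarrow> 'v" where
  "cochain_scale sv c \<alpha> = (\<lambda>\<xi>. sv c (\<alpha> \<xi>))"

text \<open>The differential and the Lie derivative, with the degree of the argument as suffix.\<close>

definition d0 :: "('h \<Rightarrow> 'v \<Rightarrow> 'v) \<Rightarrow> 'v \<Rightarrow> 'h \<Rightarrow> 'v" where
  "d0 act v = (\<lambda>\<xi>. act \<xi> v)"

definition d2 :: "('h \<Rightarrow> 'h \<Rightarrow> 'h) \<Rightarrow> ('h \<Rightarrow> 'v \<Rightarrow> 'v) \<Rightarrow> ('h \<Rightarrow> 'h \<Rightarrow> 'v)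
    \<Rightarrow> 'h \<Rightarrow> 'h \<Rightarrow> 'h \<Rightarrow> 'v::ab_group_add" where
  "d2 br act \<omega> = (\<lambda>\<xi> \<eta> \<nu>.
    (act \<xi> (\<omega> \<eta> \<nu>) + act \<eta> (\<omega> \<nu> \<xi>) + act \<nu> (\<omega> \<xi> \<eta>))
    - (\<omega> (br \<xi> \<eta>) \<nu> + \<omega> (br \<eta> \<nu>) \<xi> + \<omega> (br \<nu> \<xi>) \<eta>))"

definition lie_deriv1 :: "('h \<Rightarrow> 'h \<Rightarrow> 'h) \<Rightarrow> ('h \<Rightarrow> 'v \<Rightarrow> 'v) \<Rightarrow> 'h \<Rightarrow> ('h \<Rightarrow> 'v)
    \<Rightarrow> 'h \<Rightarrow> 'v::ab_group_add" where
  "lie_deriv1 br act \<xi> \<alpha> = (\<lambda>\<eta>. act \<xi> (\<alpha> \<eta>) - \<alpha> (br \<xi> \<eta>))"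

definition lie_deriv2 :: "('h \<Rightarrow> 'h \<Rightarrow> 'h) \<Rightarrow> ('h \<Rightarrow> 'v \<Rightarrow> 'v) \<Rightarrow> 'h \<Rightarrow> ('h \<Rightarrow> 'h \<Rightarrow> 'v)
    \<Rightarrow> 'h \<Rightarrow> 'h \<Rightarrow> 'v::ab_group_add" where
  "lie_deriv2 br act \<xi> \<omega> = (\<lambda>\<eta> \<nu>. act \<xi> (\<omega> \<eta> \<nu>) - \<omega> (br \<xi> \<eta>) \<nu> - \<omega> \<eta> (br \<xi> \<nu>))"

text \<open>\<open>'c\<close> is the value type of a cochain of one degree less.\<close>

definition ins :: "'h \<Rightarrow> ('h \<Rightarrow> 'c) \<Rightarrow> 'c" where
  "ins \<xi> \<omega> = \<omega> \<xi>"

section \<open>Symplectic and hamiltonian elements, admissible vectors\<close>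

definition sp :: "('h \<Rightarrow> 'h \<Rightarrow> 'h) \<Rightarrow> ('h \<Rightarrow> 'v \<Rightarrow> 'v) \<Rightarrow> ('h \<Rightarrow> 'h \<Rightarrow> 'v::ab_group_add) \<Rightarrow> 'h set"
  where "sp br act \<omega> = {\<xi>. lie_deriv2 br act \<xi> \<omega> = 0 \<and> ins \<xi> (d2 br act \<omega>) = 0}"

definition ham :: "('h \<Rightarrow> 'h \<Rightarrow> 'h) \<Rightarrow> ('h \<Rightarrow> 'v \<Rightarrow> 'v) \<Rightarrow> ('h \<Rightarrow> 'h \<Rightarrow> 'v::ab_group_add) \<Rightarrow> 'h set"
  where "ham br act \<omega> = {\<xi> \<in> sp br act \<omega>. \<exists>v. ins \<xi> \<omega> = d0 act v}"

definition admissible :: "('h \<Rightarrow> 'h \<Rightarrow> 'h) \<Rightarrow> ('h \<Rightarrow> 'v \<Rightarrow> 'v) \<Rightarrow> ('h \<Rightarrow> 'h \<Rightarrow> 'v::ab_group_add) \<Rightarrow> 'v set"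
  where "admissible br act \<omega> = {v. \<exists>\<xi>\<in>ham br act \<omega>. d0 act v = ins \<xi> \<omega>}"

definition invariants :: "('h \<Rightarrow> 'v \<Rightarrow> 'v::zero) \<Rightarrow> 'v set" where
  "invariants act = {v. \<forall>\<xi>. act \<xi> v = 0}"

definition rad :: "('h \<Rightarrow> 'h \<Rightarrow> 'h) \<Rightarrow> ('h \<Rightarrow> 'v \<Rightarrow> 'v) \<Rightarrow> ('h \<Rightarrow> 'h \<Rightarrow> 'v::ab_group_add) \<Rightarrow> 'h set"
  where "rad br act \<omega> = {\<xi>. ins \<xi> \<omega> = 0 \<and> ins \<xi> (d2 br act \<omega>) = 0}"

definition h_omega :: "('h \<Rightarrow> 'h \<Rightarrow> 'h) \<Rightarrow> ('h \<Rightarrow> 'v \<Rightarrow> 'v) \<Rightarrow> ('h \<Rightarrow> 'h \<Rightarrow> 'v::ab_group_add) \<Rightarrow> 'h set"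
  where "h_omega br act \<omega> =
    {\<xi>. ins \<xi> (d2 br act \<omega>) = 0 \<and> br \<xi> ` rad br act \<omega> \<subseteq> rad br act \<omega>}"

definition C1_omega :: "('h \<Rightarrow> 'h \<Rightarrow> 'h) \<Rightarrow> ('h \<Rightarrow> 'v \<Rightarrow> 'v) \<Rightarrow> ('h \<Rightarrow> 'h \<Rightarrow> 'v::ab_group_add)
    \<Rightarrow> ('h \<Rightarrow> 'v) set"
  where "C1_omega br act \<omega> = (\<lambda>\<xi>. ins \<xi> \<omega>) ` h_omega br act \<omega>"

section \<open>The brackets\<close>

text \<open>
  Each bracket is defined through representatives and is meaningful only on the stated carrier and
  once independence of the representatives is known.
\<close>

definition adm_bracket :: "('h \<Rightarrow> 'h \<Rightarrow> 'h) \<Rightarrow> ('h \<Rightarrow> 'v \<Rightarrow> 'v) \<Rightarrow> ('h \<Rightarrow> 'h \<Rightarrow> 'v::ab_group_add)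
    \<Rightarrow> 'v \<Rightarrow> 'v \<Rightarrow> 'v"
  where "adm_bracket br act \<omega> v1 v2 =
    (THE u. \<exists>\<xi>1\<in>ham br act \<omega>. \<exists>\<xi>2\<in>ham br act \<omega>.
      d0 act v1 = ins \<xi>1 \<omega> \<and> d0 act v2 = ins \<xi>2 \<omega> \<and> u = - \<omega> \<xi>1 \<xi>2)"

definition d_adm_bracket :: "('h \<Rightarrow> 'h \<Rightarrow> 'h) \<Rightarrow> ('h \<Rightarrow> 'v \<Rightarrow> 'v) \<Rightarrow> ('h \<Rightarrow> 'h \<Rightarrow> 'v::ab_group_add)
    \<Rightarrow> ('h \<Rightarrow> 'v) \<Rightarrow> ('h \<Rightarrow> 'v) \<Rightarrow> 'h \<Rightarrow> 'v"
  where "d_adm_bracket br act \<omega> \<alpha>1 \<alpha>2 =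
    (THE \<gamma>. \<exists>v1\<in>admissible br act \<omega>. \<exists>v2\<in>admissible br act \<omega>.
      \<alpha>1 = d0 act v1 \<and> \<alpha>2 = d0 act v2 \<and> \<gamma> = d0 act (adm_bracket br act \<omega> v1 v2))"

definition C1_bracket :: "('h \<Rightarrow> 'h \<Rightarrow> 'h) \<Rightarrow> ('h \<Rightarrow> 'v \<Rightarrow> 'v) \<Rightarrow> ('h \<Rightarrow> 'h \<Rightarrow> 'v::ab_group_add)
    \<Rightarrow> ('h \<Rightarrow> 'v) \<Rightarrow> ('h \<Rightarrow> 'v) \<Rightarrow> 'h \<Rightarrow> 'v"
  where "C1_bracket br act \<omega> \<alpha>1 \<alpha>2 =
    (THE \<gamma>. \<exists>\<xi>1\<in>h_omega br act \<omega>. \<exists>\<xi>2\<in>h_omega br act \<omega>.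
      \<alpha>1 = ins \<xi>1 \<omega> \<and> \<alpha>2 = ins \<xi>2 \<omega> \<and> \<gamma> = ins (br \<xi>1 \<xi>2) \<omega>)"

definition adm_lie :: "('h \<Rightarrow> 'h \<Rightarrow> 'h) \<Rightarrow> ('k \<Rightarrow> 'v \<Rightarrow> 'v) \<Rightarrow> ('h \<Rightarrow> 'v \<Rightarrow> 'v)
    \<Rightarrow> ('h \<Rightarrow> 'h \<Rightarrow> 'v) \<Rightarrow> ('k, 'v::ab_group_add) lie_alg"
  where "adm_lie br sv act \<omega> = lie_on sv (admissible br act \<omega>) (adm_bracket br act \<omega>)"

definition d_adm_lie :: "('h \<Rightarrow> 'h \<Rightarrow> 'h) \<Rightarrow> ('k \<Rightarrow> 'v \<Rightarrow> 'v) \<Rightarrow> ('h \<Rightarrow> 'v \<Rightarrow> 'v)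
    \<Rightarrow> ('h \<Rightarrow> 'h \<Rightarrow> 'v) \<Rightarrow> ('k, 'h \<Rightarrow> 'v::ab_group_add) lie_alg"
  where "d_adm_lie br sv act \<omega> =
    lie_on (cochain_scale sv) (d0 act ` admissible br act \<omega>) (d_adm_bracket br act \<omega>)"

definition C1_lie :: "('h \<Rightarrow> 'h \<Rightarrow> 'h) \<Rightarrow> ('k \<Rightarrow> 'v \<Rightarrow> 'v) \<Rightarrow> ('h \<Rightarrow> 'v \<Rightarrow> 'v)
    \<Rightarrow> ('h \<Rightarrow> 'h \<Rightarrow> 'v) \<Rightarrow> ('k, 'h \<Rightarrow> 'v::ab_group_add) lie_alg"
  where "C1_lie br sv act \<omega> =
    lie_on (cochain_scale sv) (C1_omega br act \<omega>) (C1_bracket br act \<omega>)"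

text \<open>The maps \<open>q\<close> and \<open>i\<^sup>\<omega>\<close>, undefined outside their domains.\<close>

definition q_map :: "('h \<Rightarrow> 'h \<Rightarrow> 'h) \<Rightarrow> ('h \<Rightarrow> 'v \<Rightarrow> 'v) \<Rightarrow> ('h \<Rightarrow> 'h \<Rightarrow> 'v::ab_group_add)
    \<Rightarrow> 'h \<Rightarrow> 'h \<Rightarrow> 'v"
  where "q_map br act \<omega> = (\<lambda>\<xi>\<in>ham br act \<omega>. ins \<xi> \<omega>)"

definition i_map :: "('h \<Rightarrow> 'h \<Rightarrow> 'h) \<Rightarrow> ('h \<Rightarrow> 'v \<Rightarrow> 'v) \<Rightarrow> ('h \<Rightarrow> 'h \<Rightarrow> 'v::ab_group_add)
    \<Rightarrow> 'h \<Rightarrow> 'h \<Rightarrow> 'v"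
  where "i_map br act \<omega> = (\<lambda>\<xi>\<in>h_omega br act \<omega>. ins \<xi> \<omega>)"

end

theory Submission
  imports Defs
begin

text \<open>
  Everything follows from the Cartan calculus: \<open>L\<^sub>\<xi> = d i\<^sub>\<xi> + i\<^sub>\<xi> d\<close> (lemma \<open>cartan_formula\<close>),
  \<open>i\<^bsub>[\<xi>,\<eta>]\<^esub> = L\<^sub>\<xi> i\<^sub>\<eta> - i\<^sub>\<eta> L\<^sub>\<xi>\<close> (\<open>ins_bracket\<close>), \<open>L\<^sub>\<xi> d = d L\<^sub>\<xi>\<close> (\<open>lie_deriv_d2\<close>) and \<open>d d = 0\<close>
  (\<open>d1_d0\<close>, \<open>d2_d1\<close>). They imply that the elements \<open>\<xi>\<close> with \<open>i\<^sub>\<xi> d\<omega> = 0\<close> are closed under the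
  bracket (\<open>d2_bracket\<close>). Call \<open>(\<xi>, v)\<close> a hamiltonian pair if \<open>i\<^sub>\<xi> d\<omega> = 0\<close> and \<open>i\<^sub>\<xi> \<omega> = d v\<close>. For two
  such pairs, \<open>([\<xi>, \<eta>], \<xi>.w)\<close> is again one (\<open>hamiltonian_pair_bracket\<close>).

  The bracket of admissible vectors is \<open>- \<omega>(\<xi>, \<eta>) = \<xi>.w = - \<eta>.v\<close>. The first expression shows that
  it does not depend on the choice of \<open>\<xi>\<close> and \<open>\<eta>\<close> and that it is alternating, the other two show
  bilinearity, and the Jacobi identity is the module law \<open>[\<xi>, \<eta>].u = \<xi>.\<eta>.u - \<eta>.\<xi>.u\<close>
  (\<open>lie_algebra_adm\<close>).

  The bracket on \<open>{i\<^sub>\<xi> \<omega> : \<xi> \<in> \<hh>\<^sub>\<omega>}\<close> does not depend on representatives because the kernel of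
  \<open>\<xi> \<mapsto> i\<^sub>\<xi> \<omega>\<close> on \<open>\<hh>\<^sub>\<omega>\<close> is the radical, which \<open>\<hh>\<^sub>\<omega>\<close> normalizes (\<open>C1_bracket_ins\<close>). The axioms of a
  Lie algebra on \<open>d (V\<^sub>\<omega>)\<close>, on \<open>V\<^sub>\<omega> / V\<^sup>\<hh>\<close> and on \<open>{i\<^sub>\<xi> \<omega> : \<xi> \<in> \<hh>\<^sub>\<omega>}\<close> are transported along surjections
  (\<open>lie_hom_onto_structure\<close>).
\<close>

section \<open>Lie algebras on a carrier\<close>

context lie_algebra
begin

lemma right_zero: "x \<in> lcarrier L \<Longrightarrow> ladd L x (lzero L) = x"
  using add_commute[of x "lzero L"] add_zero zero_closed by simp

lemma add_cancel_self:
  assumes "x \<in> lcarrier L" and "ladd L x x = x"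
  shows "x = lzero L"
proof -
  obtain y where y: "y \<in> lcarrier L" "ladd L y x = lzero L"
    using add_inverse assms(1) by blast
  have "x = ladd L (ladd L y x) x" using y assms by (simp add: add_zero)
  also have "\<dots> = ladd L y (ladd L x x)" using y assms(1) add_assoc by blast
  finally show ?thesis using y assms by simp
qed

lemma subtraction:
  assumes "x \<in> lcarrier L" and "y \<in> lcarrier L"
  obtains z where "z \<in> lcarrier L" and "ladd L x z = y"
proof -
  obtain w where w: "w \<in> lcarrier L" "ladd L w x = lzero L"
    using add_inverse assms(1) by blast
  have "ladd L x (ladd L w y) = ladd L (ladd L w x) y"
    using assms w by (simp add: add_assoc[symmetric] add_commute[of x w])
  then show thesis
    using that[of "ladd L w y"] assms w by (simp add: add_zero add_closed)
qed

end

lemma lie_hom_zero: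
  assumes "lie_hom L M f"
  shows "f (lzero L) = lzero M"
proof -
  interpret L: lie_algebra L using assms by (simp add: lie_hom_def)
  interpret M: lie_algebra M using assms by (simp add: lie_hom_def)
  have "ladd M (f (lzero L)) (f (lzero L)) = f (ladd L (lzero L) (lzero L))"
    using assms L.zero_closed by (simp add: lie_hom_def)
  also have "\<dots> = f (lzero L)" by (simp add: L.add_zero L.zero_closed)
  finally show ?thesis
    using M.add_cancel_self assms L.zero_closed by (auto simp: lie_hom_def)
qed

text \<open>
  The axioms are equations and the existence of additive inverses, and both survive a surjection
  that respects the operations. Every Lie algebra below other than the subalgebras of \<open>\<hh>\<close> and the
  admissible vectors is recognised in this way.
\<close>

lemma lie_hom_onto_structure:
  assumes "lie_algebra L" and onto: "f ` lcarrier L = lcarrier M"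
    and zero: "f (lzero L) = lzero M"
    and add: "\<And>x y. \<lbrakk>x \<in> lcarrier L; y \<in> lcarrier L\<rbrakk> \<Longrightarrow> ladd M (f x) (f y) = f (ladd L x y)"
    and scale: "\<And>c x. x \<in> lcarrier L \<Longrightarrow> lscale M c (f x) = f (lscale L c x)"
    and bracket: "\<And>x y. \<lbrakk>x \<in> lcarrier L; y \<in> lcarrier L\<rbrakk>
      \<Longrightarrow> lbracket M (f x) (f y) = f (lbracket L x y)"
  shows "lie_hom L M f"
proof -
  interpret L: lie_algebra L by fact
  note hom = zero[symmetric] add scale bracket
  note closed = L.zero_closed L.add_closed L.scale_closed L.bracket_closed
  have "lie_algebra M"
  proof (unfold_locales, unfold onto[symmetric], goal_cases)
    \<comment> \<open>Commutativity and additive inverses; the other axioms are rewritten directly.\<close>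
    case (4 x y)
    then obtain a b where "x = f a" "y = f b" "a \<in> lcarrier L" "b \<in> lcarrier L" by blast
    then show ?case using L.add_commute[of a b] by (simp add: hom)
  next
    case (6 x)
    then obtain a where a: "x = f a" "a \<in> lcarrier L" by blast
    then obtain b where "b \<in> lcarrier L" "ladd L b a = lzero L" using L.add_inverse by blast
    then show ?case using a by (intro bexI[of _ "f b"]) (simp_all add: hom)
  qed (auto simp: hom closed L.add_assoc L.add_zero L.scale_add_right L.scale_add_left
      L.scale_scale L.scale_one L.bracket_add_left L.bracket_add_right L.bracket_scale_left
      L.bracket_scale_right L.bracket_self L.jacobi)
  then show ?thesis using assms by (auto simp: lie_hom_def)
qed

text \<open>
  The cosets of the kernel are the fibres of the homomorphism; this makes the operations of the
  quotient independent of representatives.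
\<close>

theorem lie_first_isomorphism:
  assumes hom: "lie_hom L M f" and onto: "f ` lcarrier L = lcarrier M"
    and ker: "I = {x \<in> lcarrier L. f x = lzero M}"
  shows "\<exists>\<Phi>. lie_iso (lie_quotient L I) M \<Phi> \<and> (\<forall>x\<in>lcarrier L. \<Phi> (lie_coset L I x) = f x)"
proof -
  interpret L: lie_algebra L using hom by (simp add: lie_hom_def)
  interpret M: lie_algebra M using hom by (simp add: lie_hom_def)
  have f_in: "x \<in> lcarrier L \<Longrightarrow> f x \<in> lcarrier M" for x
    using hom by (auto simp: lie_hom_def)
  have f_add: "\<lbrakk>x \<in> lcarrier L; y \<in> lcarrier L\<rbrakk> \<Longrightarrow> f (ladd L x y) = ladd M (f x) (f y)" for x y
    using hom by (simp add: lie_hom_def)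
  have f_scale: "x \<in> lcarrier L \<Longrightarrow> f (lscale L c x) = lscale M c (f x)" for c x
    using hom by (simp add: lie_hom_def)
  have f_bracket: "\<lbrakk>x \<in> lcarrier L; y \<in> lcarrier L\<rbrakk>
      \<Longrightarrow> f (lbracket L x y) = lbracket M (f x) (f y)" for x y
    using hom by (simp add: lie_hom_def)
  define fib where "fib t = {y \<in> lcarrier L. f y = t}" for t
  have coset: "lie_coset L I x = fib (f x)" if x: "x \<in> lcarrier L" for x
  proof
    show "lie_coset L I x \<subseteq> fib (f x)"
      using x by (auto simp: lie_coset_def fib_def ker f_add f_in M.right_zero L.add_closed)
    show "fib (f x) \<subseteq> lie_coset L I x"
    proof
      fix y assume "y \<in> fib (f x)"
      then have y: "y \<in> lcarrier L" "f y = f x" by (auto simp: fib_def)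
      obtain w where w: "w \<in> lcarrier L" "ladd L x w = y"
        using L.subtraction y x by blast
      obtain u where u: "u \<in> lcarrier M" "ladd M u (f x) = lzero M"
        using M.add_inverse f_in x by blast
      have "f w = ladd M (ladd M u (f x)) (f w)" using u w by (simp add: M.add_zero f_in)
      also have "\<dots> = ladd M u (f (ladd L x w))"
        unfolding f_add[OF x w(1)] using u(1) w x by (simp only: M.add_assoc f_in)
      also have "\<dots> = lzero M" using u w y by simp
      finally show "y \<in> lie_coset L I x" using w by (auto simp: lie_coset_def ker)
    qed
  qed
  have rep: "x \<in> fib (f x)" if "x \<in> lcarrier L" for x using that by (simp add: fib_def)
  have quot: "lie_hom L (lie_quotient L I) (lie_coset L I)"
  proof (rule lie_hom_onto_structure)
    show "lie_algebra L" by (fact L.lie_algebra_axioms)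
    show "lie_coset L I ` lcarrier L = lcarrier (lie_quotient L I)"
      by (simp add: lie_quotient_def)
    show "lie_coset L I (lzero L) = lzero (lie_quotient L I)"
      using coset[OF L.zero_closed] lie_hom_zero[OF hom] by (simp add: lie_quotient_def fib_def ker)
  next
    fix x y assume xy: "x \<in> lcarrier L" "y \<in> lcarrier L"
    have "(\<Union>a\<in>fib (f x). \<Union>b\<in>fib (f y). lie_coset L I (ladd L a b))
        = (\<Union>a\<in>fib (f x). \<Union>b\<in>fib (f y). fib (ladd M (f x) (f y)))"
      by (intro SUP_cong refl) (auto simp: fib_def[of "f _"] coset L.add_closed f_add)
    then show "ladd (lie_quotient L I) (lie_coset L I x) (lie_coset L I y)
        = lie_coset L I (ladd L x y)"
      using xy rep[of x] rep[of y]
      by (simp add: lie_quotient_def coset L.add_closed f_add) blast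
    have "(\<Union>a\<in>fib (f x). \<Union>b\<in>fib (f y). lie_coset L I (lbracket L a b))
        = (\<Union>a\<in>fib (f x). \<Union>b\<in>fib (f y). fib (lbracket M (f x) (f y)))"
      by (intro SUP_cong refl) (auto simp: fib_def[of "f _"] coset L.bracket_closed f_bracket)
    then show "lbracket (lie_quotient L I) (lie_coset L I x) (lie_coset L I y)
        = lie_coset L I (lbracket L x y)"
      using xy rep[of x] rep[of y]
      by (simp add: lie_quotient_def coset L.bracket_closed f_bracket) blast
  next
    fix c x assume x: "x \<in> lcarrier L"
    have "(\<Union>a\<in>fib (f x). lie_coset L I (lscale L c a)) = (\<Union>a\<in>fib (f x). fib (lscale M c (f x)))"
      by (intro SUP_cong refl) (auto simp: fib_def[of "f _"] coset L.scale_closed f_scale)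
    then show "lscale (lie_quotient L I) c (lie_coset L I x) = lie_coset L I (lscale L c x)"
      using x rep[of x]
      by (simp add: lie_quotient_def coset L.scale_closed f_scale) blast
  qed
  define \<Phi> where "\<Phi> A = f (SOME a. a \<in> A)" for A
  have \<Phi>: "\<Phi> (lie_coset L I x) = f x" if x: "x \<in> lcarrier L" for x
    using someI[of "\<lambda>a. a \<in> fib (f x)", OF rep[OF x]] by (simp add: \<Phi>_def coset x fib_def)
  have carrier: "lcarrier (lie_quotient L I) = lie_coset L I ` lcarrier L"
    by (simp add: lie_quotient_def)
  have quot_ops:
    "\<And>x y. \<lbrakk>x \<in> lcarrier L; y \<in> lcarrier L\<rbrakk>
      \<Longrightarrow> ladd (lie_quotient L I) (lie_coset L I x) (lie_coset L I y) = lie_coset L I (ladd L x y)"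
    "\<And>c x. x \<in> lcarrier L \<Longrightarrow> lscale (lie_quotient L I) c (lie_coset L I x)
      = lie_coset L I (lscale L c x)"
    "\<And>x y. \<lbrakk>x \<in> lcarrier L; y \<in> lcarrier L\<rbrakk>
      \<Longrightarrow> lbracket (lie_quotient L I) (lie_coset L I x) (lie_coset L I y) = lie_coset L I (lbracket L x y)"
    using quot by (simp_all add: lie_hom_def)
  have "lie_hom (lie_quotient L I) M \<Phi>"
  proof (rule lie_hom_onto_structure)
    show "lie_algebra (lie_quotient L I)" using quot by (simp add: lie_hom_def)
    show "\<Phi> ` lcarrier (lie_quotient L I) = lcarrier M"
      unfolding carrier image_image onto[symmetric] by (rule image_cong) (simp_all add: \<Phi>)
    show "\<Phi> (lzero (lie_quotient L I)) = lzero M"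
      using \<Phi>[OF L.zero_closed] lie_hom_zero[OF hom] lie_hom_zero[OF quot] by simp
  qed (auto simp: carrier quot_ops \<Phi> f_add f_scale f_bracket L.add_closed L.scale_closed
      L.bracket_closed)
  moreover have "inj_on \<Phi> (lcarrier (lie_quotient L I))"
    by (auto simp: carrier inj_on_def \<Phi>) (simp_all add: coset)
  moreover have "\<Phi> ` lcarrier (lie_quotient L I) = lcarrier M"
    unfolding carrier image_image onto[symmetric] by (rule image_cong) (simp_all add: \<Phi>)
  ultimately show ?thesis using \<Phi> by (auto simp: lie_iso_def bij_betw_def)
qed

lemma lie_algebra_subset:
  fixes br :: "'a::ab_group_add \<Rightarrow> 'a \<Rightarrow> 'a"
  assumes "lie_algebra (lie_on s UNIV br)"
    and "0 \<in> S" and "\<And>x y. \<lbrakk>x \<in> S; y \<in> S\<rbrakk> \<Longrightarrow> x + y \<in> S" and "\<And>c x. x \<in> S \<Longrightarrow> s c x \<in> S"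
    and "\<And>x y. \<lbrakk>x \<in> S; y \<in> S\<rbrakk> \<Longrightarrow> br x y \<in> S"
  shows "lie_algebra (lie_on s S br)"
proof -
  interpret L: lie_algebra "lie_on s UNIV br" by fact
  note ax = L.add_inverse L.scale_add_right L.scale_add_left L.scale_scale L.scale_one
    L.bracket_add_left L.bracket_add_right L.bracket_scale_left L.bracket_scale_right
    L.bracket_self L.jacobi
  have minus: "- x \<in> S" if "x \<in> S" for x
  proof -
    have "s (-1) x + x = s (-1 + 1) x"
      using L.scale_add_left[of x "-1" 1] L.scale_one[of x] by (simp add: lie_on_def)
    also have "\<dots> = 0"
      using L.scale_add_left[of x 0 0] by (simp add: lie_on_def)
    finally have "s (-1) x = - x" by (simp add: eq_neg_iff_add_eq_0)
    with that show ?thesis using assms(4)[of x "-1"] by simp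
  qed
  show ?thesis
    using assms(2-5) ax minus
    by unfold_locales (auto simp: lie_on_def algebra_simps intro: bexI[of _ "- _"])
qed

section \<open>Cartan calculus in low degrees\<close>

definition d1 :: "('h \<Rightarrow> 'h \<Rightarrow> 'h) \<Rightarrow> ('h \<Rightarrow> 'v \<Rightarrow> 'v) \<Rightarrow> ('h \<Rightarrow> 'v) \<Rightarrow> 'h \<Rightarrow> 'h \<Rightarrow> 'v::ab_group_add" where
  "d1 br act \<alpha> = (\<lambda>\<xi> \<eta>. act \<xi> (\<alpha> \<eta>) - act \<eta> (\<alpha> \<xi>) - \<alpha> (br \<xi> \<eta>))"

context topological_lie_module
begin

lemma lie_h: "lie_algebra (lie_on sh UNIV br)"
  by (fact h.lie_algebra)

lemma br_add_left: "br (x + y) z = br x z + br y z"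
  using lie_algebra.bracket_add_left[OF lie_h, of x y z] by (simp add: lie_on_def)

lemma br_add_right: "br x (y + z) = br x y + br x z"
  using lie_algebra.bracket_add_right[OF lie_h, of x y z] by (simp add: lie_on_def)

lemma br_scale_left: "br (sh c x) y = sh c (br x y)"
  using lie_algebra.bracket_scale_left[OF lie_h, of x y c] by (simp add: lie_on_def)

lemma br_scale_right: "br x (sh c y) = sh c (br x y)"
  using lie_algebra.bracket_scale_right[OF lie_h, of x y c] by (simp add: lie_on_def)

lemma br_self: "br x x = 0"
  using lie_algebra.bracket_self[OF lie_h, of x] by (simp add: lie_on_def)

lemma br_antisym: "br x y = - br y x"
proof -
  have "br (x + y) (x + y) = (br x x + br x y) + (br y x + br y y)"
    by (simp only: br_add_left br_add_right ac_simps)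
  then have "br x y + br y x = 0" by (simp add: br_self)
  then show ?thesis by (simp add: eq_neg_iff_add_eq_0)
qed

sublocale br_left: additive "\<lambda>x. br x y" for y by unfold_locales (rule br_add_left)
sublocale br_right: additive "br x" for x by unfold_locales (rule br_add_right)

lemma br_derivation: "br x (br y z) = br (br x y) z + br y (br x z)"
proof -
  have "br x (br y z) + (br y (br z x) + br z (br x y)) = 0"
    using lie_algebra.jacobi[OF lie_h, of x y z] by (simp add: lie_on_def)
  moreover have "br y (br z x) = - br y (br x z)" "br z (br x y) = - br (br x y) z"
    by (metis br_antisym br_right.minus) (rule br_antisym)
  ultimately show ?thesis by (simp add: algebra_simps)
qed

sublocale act_left: additive "\<lambda>x. act x v" for v
  by unfold_locales (rule module_hom.add[OF Vector_Spaces.module_hom_linearI[OF linear_act_left]])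
sublocale act_right: additive "act x" for x
  by unfold_locales (rule module_hom.add[OF Vector_Spaces.module_hom_linearI[OF linear_act_right]])

lemma act_scale_left: "act (sh c x) v = sv c (act x v)"
  by (rule module_hom.scale[OF Vector_Spaces.module_hom_linearI[OF linear_act_left]])

lemma act_scale_right: "act x (sv c v) = sv c (act x v)"
  by (rule module_hom.scale[OF Vector_Spaces.module_hom_linearI[OF linear_act_right]])

lemmas additive_simps =
  br_left.add br_left.diff br_left.minus br_left.zero
  br_right.add br_right.diff br_right.minus br_right.zero
  act_left.add act_left.diff act_left.minus act_left.zero
  act_right.add act_right.diff act_right.minus act_right.zero

lemma d1_d0: "d1 br act (d0 act v) = 0"
  by (simp add: d1_def d0_def act_bracket fun_eq_iff)

text \<open>
  The terms \<open>a.b.\<alpha>(c)\<close> and \<open>a.\<alpha>([b, c])\<close> cancel by the module law; what remains is \<open>\<alpha>\<close> of the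
  Jacobi sum.
\<close>

lemma d2_d1:
  assumes "additive \<alpha>"
  shows "d2 br act (d1 br act \<alpha>) = 0"
proof (intro ext)
  fix a b c
  interpret \<alpha>: additive \<alpha> by fact
  have "br a (br b c) = br (br a b) c - br (br a c) b"
    by (subst br_derivation) (simp add: br_antisym[of b "br a c"])
  moreover have "br (br c a) b = - br (br a c) b"
    by (subst br_antisym[of c a]) (rule br_left.minus)
  moreover have "br (br b c) a = - br a (br b c)"
    by (rule br_antisym)
  ultimately have "\<alpha> (br (br a b) c) + \<alpha> (br (br b c) a) + \<alpha> (br (br c a) b) = 0"
    by (simp add: \<alpha>.zero flip: \<alpha>.add)
  then show "d2 br act (d1 br act \<alpha>) a b c = 0 a b c"
    by (simp add: d2_def d1_def additive_simps act_bracket algebra_simps)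
qed

text \<open>
  The Lie derivative commutes with the differential because \<open>\<xi>\<close> acts as a derivation of all the
  operations from which the differential is built.
\<close>

lemma lie_deriv_d2:
  assumes "\<And>x. additive (\<omega> x)" and "\<And>y. additive (\<lambda>x. \<omega> x y)"
  shows "act \<xi> (d2 br act \<omega> a b c) - d2 br act \<omega> (br \<xi> a) b c - d2 br act \<omega> a (br \<xi> b) c
      - d2 br act \<omega> a b (br \<xi> c) = d2 br act (lie_deriv2 br act \<xi> \<omega>) a b c"
proof -
  interpret R: additive "\<omega> x" for x by fact
  interpret L: additive "\<lambda>x. \<omega> x y" for y by fact
  have "act \<xi> (act x v) = act (br \<xi> x) v + act x (act \<xi> v)" for x v
    by (simp add: act_bracket)
  note swap = this[of a] this[of b] this[of c]
  show ?thesis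
    by (simp add: d2_def lie_deriv2_def additive_simps L.add R.add swap br_derivation[of \<xi> a b]
        br_derivation[of \<xi> b c] br_derivation[of \<xi> c a] algebra_simps)
qed

text \<open>
  Cartan's formula \<open>L\<^sub>\<xi> = d i\<^sub>\<xi> + i\<^sub>\<xi> d\<close>: antisymmetry turns the terms of \<open>d \<omega>(\<xi>, a, b)\<close> in which
  \<open>\<xi>\<close> has left the first argument into those of \<open>L\<^sub>\<xi> \<omega>\<close> and \<open>- d i\<^sub>\<xi> \<omega>\<close>.
\<close>

lemma cartan_formula:
  assumes alt: "\<And>x y. \<omega> x y = - \<omega> y x" and "\<And>x. additive (\<omega> x)"
  shows "lie_deriv2 br act \<xi> \<omega> = d1 br act (\<omega> \<xi>) + d2 br act \<omega> \<xi>"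
proof (intro ext)
  fix a b
  interpret R: additive "\<omega> x" for x by fact
  have "\<omega> (br b \<xi>) a = \<omega> a (br \<xi> b)"
    by (subst alt, subst br_antisym) (simp add: R.minus)
  then show "lie_deriv2 br act \<xi> \<omega> a b = (d1 br act (\<omega> \<xi>) + d2 br act \<omega> \<xi>) a b"
    using alt[of b \<xi>] alt[of "br a b" \<xi>]
    by (simp add: lie_deriv2_def d1_def d2_def additive_simps)
qed

lemma lie_deriv1_d0: "lie_deriv1 br act \<xi> (d0 act v) = d0 act (act \<xi> v)"
  by (simp add: lie_deriv1_def d0_def act_bracket fun_eq_iff)

text \<open>The commutator formula \<open>i\<^bsub>[\<xi>,\<eta>]\<^esub> = L\<^sub>\<xi> i\<^sub>\<eta> - i\<^sub>\<eta> L\<^sub>\<xi>\<close>.\<close>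

lemma ins_bracket:
  "\<omega> (br \<xi> \<eta>) = lie_deriv1 br act \<xi> (\<omega> \<eta>) - lie_deriv2 br act \<xi> \<omega> \<eta>"
  by (simp add: lie_deriv1_def lie_deriv2_def fun_eq_iff)

end

section \<open>Hamiltonian elements and admissible vectors\<close>

locale lie_cochain = topological_lie_module sh br sv act
  for sh :: "'k::{field, topological_ab_group_add, topological_semigroup_mult}
      \<Rightarrow> 'h::topological_ab_group_add \<Rightarrow> 'h"
    and br :: "'h \<Rightarrow> 'h \<Rightarrow> 'h"
    and sv :: "'k \<Rightarrow> 'v::topological_ab_group_add \<Rightarrow> 'v"
    and act :: "'h \<Rightarrow> 'v \<Rightarrow> 'v" +
  fixes \<omega> :: "'h \<Rightarrow> 'h \<Rightarrow> 'v"
  assumes cochain: "\<omega> \<in> cochains2 sh sv"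
begin

sublocale omega_left: additive "\<lambda>x. \<omega> x y" for y
  by unfold_locales (rule module_hom.add[of sh sv, OF Vector_Spaces.module_hom_linearI],
      use cochain in \<open>simp add: cochains2_def\<close>)
sublocale omega_right: additive "\<omega> x" for x
  by unfold_locales (rule module_hom.add[of sh sv, OF Vector_Spaces.module_hom_linearI],
      use cochain in \<open>simp add: cochains2_def\<close>)

lemma omega_scale_left: "\<omega> (sh c x) y = sv c (\<omega> x y)"
  using cochain module_hom.scale[OF Vector_Spaces.module_hom_linearI, of sh sv "\<lambda>x. \<omega> x y"]
  by (auto simp: cochains2_def)

lemma omega_antisym: "\<omega> x y = - \<omega> y x"
proof -
  have self: "\<omega> z z = 0" for z using cochain by (simp add: cochains2_def)
  have "\<omega> (x + y) (x + y) = (\<omega> x x + \<omega> x y) + (\<omega> y x + \<omega> y y)"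
    by (simp only: omega_left.add omega_right.add ac_simps)
  then have "\<omega> x y + \<omega> y x = 0" by (simp add: self)
  then show ?thesis by (simp add: eq_neg_iff_add_eq_0)
qed

lemma omega_scale_right: "\<omega> x (sh c y) = sv c (\<omega> x y)"
  by (subst (1 2) omega_antisym) (simp add: omega_scale_left h.scale_minus_right V.scale_minus_right)

lemma omega_add: "\<omega> (x + y) = \<omega> x + \<omega> y"
  by (simp add: fun_eq_iff omega_left.add)

lemma omega_scale: "\<omega> (sh c x) = cochain_scale sv c (\<omega> x)"
  by (simp add: fun_eq_iff cochain_scale_def omega_scale_left)

lemma omega_zero: "\<omega> 0 = 0"
  by (simp add: fun_eq_iff omega_left.zero)

lemma omega_diff: "\<omega> (x - y) = \<omega> x - \<omega> y"
  by (simp add: fun_eq_iff omega_left.diff)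

abbreviation (input) d\<omega> where "d\<omega> \<equiv> d2 br act \<omega>"

lemma d2_add: "d\<omega> (x + y) = d\<omega> x + d\<omega> y"
  by (simp add: fun_eq_iff d2_def additive_simps omega_left.add omega_right.add algebra_simps)

lemma d2_scale: "d\<omega> (sh c x) a b = sv c (d\<omega> x a b)"
  by (simp add: d2_def act_scale_left act_scale_right omega_scale_left omega_scale_right
      br_scale_left br_scale_right V.scale_right_distrib V.scale_right_diff_distrib)

sublocale d2_left: additive d\<omega>
  by unfold_locales (rule d2_add)

lemma lie_deriv_omega: "lie_deriv2 br act \<xi> \<omega> = d1 br act (\<omega> \<xi>)" if "d\<omega> \<xi> = 0"
  using cartan_formula[of \<omega> \<xi>, OF omega_antisym omega_right.additive_axioms] that by simp

text \<open>
  If \<open>i\<^sub>\<xi> d\<omega> = 0\<close>, then \<open>L\<^sub>\<xi> d\<omega> = d L\<^sub>\<xi> \<omega> = d d i\<^sub>\<xi> \<omega> = 0\<close>, so \<open>i\<^bsub>[\<xi>,\<eta>]\<^esub> d\<omega> = L\<^sub>\<xi> i\<^sub>\<eta> d\<omega> = 0\<close>.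
  Applying \<open>d d = 0\<close> to \<open>i\<^sub>\<xi> \<omega>\<close> replaces the identity \<open>d d \<omega> = 0\<close> in degree four.
\<close>

lemma d2_bracket:
  assumes "d\<omega> \<xi> = 0" and "d\<omega> \<eta> = 0"
  shows "d\<omega> (br \<xi> \<eta>) = 0"
proof (intro ext)
  fix a b
  have "d2 br act (lie_deriv2 br act \<xi> \<omega>) = 0"
    using assms(1) by (simp add: lie_deriv_omega d2_d1 omega_right.additive_axioms)
  then show "d\<omega> (br \<xi> \<eta>) a b = 0 a b"
    using lie_deriv_d2[of \<omega> \<xi> \<eta> a b, OF omega_right.additive_axioms omega_left.additive_axioms]
      assms(2) by (simp add: additive_simps)
qed

text \<open>
  The condition \<open>L\<^sub>\<xi> \<omega> = 0\<close> on hamiltonian elements follows from the two conditions here: by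
  Cartan's formula \<open>L\<^sub>\<xi> \<omega> = d d v = 0\<close>. Stated for the pair, they are linear, and the closure
  properties of hamiltonian elements and of admissible vectors can be shown together.
\<close>

definition hamiltonian_pair :: "'h \<Rightarrow> 'v \<Rightarrow> bool" where
  "hamiltonian_pair \<xi> v \<longleftrightarrow> d\<omega> \<xi> = 0 \<and> \<omega> \<xi> = d0 act v"

lemma hamiltonian_pair_iff: "hamiltonian_pair \<xi> v \<longleftrightarrow> \<xi> \<in> ham br act \<omega> \<and> d0 act v = ins \<xi> \<omega>"
  by (auto simp: hamiltonian_pair_def ham_def sp_def ins_def lie_deriv_omega d1_d0)

lemma ham_iff: "\<xi> \<in> ham br act \<omega> \<longleftrightarrow> (\<exists>v. hamiltonian_pair \<xi> v)"
  by (auto simp: hamiltonian_pair_iff ham_def)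

lemma admissible_iff: "v \<in> admissible br act \<omega> \<longleftrightarrow> (\<exists>\<xi>. hamiltonian_pair \<xi> v)"
  by (auto simp: hamiltonian_pair_iff admissible_def)

lemma d0_add: "d0 act (v + w) = d0 act v + d0 act w"
  by (simp add: fun_eq_iff d0_def additive_simps)

lemma d0_scale: "d0 act (sv c v) = cochain_scale sv c (d0 act v)"
  by (simp add: fun_eq_iff d0_def cochain_scale_def act_scale_right)

lemma d0_zero: "d0 act 0 = 0"
  by (simp add: fun_eq_iff d0_def additive_simps)

lemma hamiltonian_pair_add:
  "\<lbrakk>hamiltonian_pair \<xi> v; hamiltonian_pair \<eta> w\<rbrakk> \<Longrightarrow> hamiltonian_pair (\<xi> + \<eta>) (v + w)"
  by (simp add: hamiltonian_pair_def d2_add omega_add d0_add)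

lemma d2_scale_zero: "d\<omega> \<xi> = 0 \<Longrightarrow> d\<omega> (sh c \<xi>) = 0"
  by (simp add: fun_eq_iff d2_scale)

lemma hamiltonian_pair_scale: "hamiltonian_pair \<xi> v \<Longrightarrow> hamiltonian_pair (sh c \<xi>) (sv c v)"
  by (simp add: hamiltonian_pair_def d2_scale_zero omega_scale d0_scale)

lemma hamiltonian_pair_zero: "hamiltonian_pair 0 0"
  by (simp add: hamiltonian_pair_def d2_left.zero omega_zero d0_zero)

text \<open>
  \<open>i\<^bsub>[\<xi>,\<eta>]\<^esub> \<omega> = L\<^sub>\<xi> i\<^sub>\<eta> \<omega> - i\<^sub>\<eta> L\<^sub>\<xi> \<omega> = L\<^sub>\<xi> d w = d (\<xi>.w)\<close>. This shows at once that the
  hamiltonian elements form a subalgebra, that \<open>\<xi>.w\<close> is admissible, and that \<open>q\<close> respects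
  brackets.
\<close>

lemma hamiltonian_pair_bracket:
  assumes "hamiltonian_pair \<xi> v" and "hamiltonian_pair \<eta> w"
  shows "hamiltonian_pair (br \<xi> \<eta>) (act \<xi> w)"
  using assms d2_bracket[of \<xi> \<eta>]
  by (simp add: hamiltonian_pair_def ins_bracket[of \<omega> \<xi> \<eta>] lie_deriv_omega d1_d0 lie_deriv1_d0)

text \<open>
  The value \<open>\<omega> \<xi> \<eta>\<close> depends only on \<open>i\<^sub>\<xi> \<omega> = d v\<close> and, by antisymmetry, on \<open>i\<^sub>\<eta> \<omega> = d w\<close>.
\<close>

lemma adm_bracket_pair:
  assumes "hamiltonian_pair \<xi> v" and "hamiltonian_pair \<eta> w"
  shows "adm_bracket br act \<omega> v w = - \<omega> \<xi> \<eta>"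
  unfolding adm_bracket_def
proof (rule the_equality)
  show "\<exists>\<xi>1\<in>ham br act \<omega>. \<exists>\<xi>2\<in>ham br act \<omega>.
      d0 act v = ins \<xi>1 \<omega> \<and> d0 act w = ins \<xi>2 \<omega> \<and> - \<omega> \<xi> \<eta> = - \<omega> \<xi>1 \<xi>2"
    using assms by (auto simp: hamiltonian_pair_iff)
next
  fix u
  assume "\<exists>\<xi>1\<in>ham br act \<omega>. \<exists>\<xi>2\<in>ham br act \<omega>.
      d0 act v = ins \<xi>1 \<omega> \<and> d0 act w = ins \<xi>2 \<omega> \<and> u = - \<omega> \<xi>1 \<xi>2"
  then obtain \<xi>1 \<xi>2 where "\<omega> \<xi>1 = \<omega> \<xi>" "\<omega> \<xi>2 = \<omega> \<eta>" "u = - \<omega> \<xi>1 \<xi>2"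
    using assms by (auto simp: hamiltonian_pair_def ins_def)
  then show "u = - \<omega> \<xi> \<eta>"
    using omega_antisym[of \<xi> \<xi>2] omega_antisym[of \<xi> \<eta>] by simp
qed

lemma adm_bracket_left:
  assumes "hamiltonian_pair \<xi> v" and "w \<in> admissible br act \<omega>"
  shows "adm_bracket br act \<omega> v w = act \<xi> w"
proof -
  obtain \<eta> where \<eta>: "hamiltonian_pair \<eta> w" using assms(2) by (auto simp: admissible_iff)
  then have "act \<xi> w = \<omega> \<eta> \<xi>" by (simp add: hamiltonian_pair_def d0_def)
  then show ?thesis using adm_bracket_pair[OF assms(1) \<eta>] omega_antisym[of \<eta> \<xi>] by simp
qed

lemma adm_bracket_right:
  assumes "v \<in> admissible br act \<omega>" and "hamiltonian_pair \<eta> w"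
  shows "adm_bracket br act \<omega> v w = - act \<eta> v"
proof -
  obtain \<xi> where \<xi>: "hamiltonian_pair \<xi> v" using assms(1) by (auto simp: admissible_iff)
  then have "act \<eta> v = \<omega> \<xi> \<eta>" by (simp add: hamiltonian_pair_def d0_def)
  then show ?thesis using adm_bracket_pair[OF \<xi> assms(2)] by simp
qed

text \<open>
  Linearity in the first argument comes from the representation \<open>{v, w} = - \<eta>.v\<close>, in the second
  one from \<open>{v, w} = \<xi>.w\<close>. The Jacobi identity says that \<open>[\<xi>, \<eta>]\<close> acts as the commutator of
  \<open>\<xi>\<close> and \<open>\<eta>\<close>.
\<close>

lemma lie_algebra_adm: "lie_algebra (adm_lie br sv act \<omega>)"
proof -
  let ?A = "admissible br act \<omega>" and ?b = "adm_bracket br act \<omega>"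
  have add: "v + w \<in> ?A" if "v \<in> ?A" "w \<in> ?A" for v w
    using that by (meson admissible_iff hamiltonian_pair_add)
  have scale: "sv c v \<in> ?A" if "v \<in> ?A" for c v
    using that by (meson admissible_iff hamiltonian_pair_scale)
  have zero: "0 \<in> ?A" using hamiltonian_pair_zero by (auto simp: admissible_iff)
  have minus: "- v \<in> ?A" if "v \<in> ?A" for v
    using scale[OF that, of "-1"] by simp
  obtain X where X: "\<And>v. v \<in> ?A \<Longrightarrow> hamiltonian_pair (X v) v"
    by (metis admissible_iff)
  have left: "?b v w = act (X v) w" if "v \<in> ?A" "w \<in> ?A" for v w
    using adm_bracket_left X that by blast
  have right: "?b v w = - act (X w) v" if "v \<in> ?A" "w \<in> ?A" for v w
    using adm_bracket_right X that by blast
  have pair: "hamiltonian_pair (br (X v) (X w)) (?b v w)" if "v \<in> ?A" "w \<in> ?A" for v w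
    using hamiltonian_pair_bracket[OF X X, OF that] left that by simp
  have closed: "?b v w \<in> ?A" if "v \<in> ?A" "w \<in> ?A" for v w
    using pair[OF that] by (auto simp: admissible_iff)
  have jacobi: "?b u (?b v w) + (?b v (?b w u) + ?b w (?b u v)) = 0"
    if "u \<in> ?A" "v \<in> ?A" "w \<in> ?A" for u v w
  proof -
    have "?b w (?b u v) = - act (br (X u) (X v)) w"
      using that adm_bracket_right pair by blast
    moreover have "?b u (?b v w) = act (X u) (act (X v) w)"
      using that closed left by simp
    moreover have "?b v (?b w u) = - act (X v) (act (X u) w)"
      using that closed[of w u] left[of v "?b w u"] right[of w u] by (simp add: additive_simps)
    ultimately show ?thesis by (simp add: act_bracket)
  qed
  have self: "?b v v = 0" if "v \<in> ?A" for v
    using adm_bracket_pair[OF X X, OF that that] cochain by (simp add: cochains2_def)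
  show ?thesis
    unfolding adm_lie_def lie_on_def
  proof (unfold_locales, simp_all only: lie_alg.simps, goal_cases)
    \<comment> \<open>Additive inverses, then additivity and homogeneity of the bracket in each argument.\<close>
    case (6 x) then show ?case by (intro bexI[of _ "- x"]) (auto simp: minus)
  next
    case (13 x y z) then show ?case by (simp add: right add additive_simps)
  next
    case (14 x y z) then show ?case by (simp add: left add additive_simps)
  next
    case (15 x y c) then show ?case by (simp add: right scale act_scale_right V.scale_minus_right)
  next
    case (16 x y c) then show ?case by (simp add: left scale act_scale_right)
  qed (simp_all add: zero add scale closed self jacobi V.scale_right_distrib V.scale_left_distrib
      add.assoc add.commute)
qed

text \<open>
  The invariant vectors are those paired with the hamiltonian element \<open>0\<close>, which acts trivially on
  \<open>V\<close>; hence they are central.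
\<close>

lemma invariants_pair: "v \<in> invariants act \<longleftrightarrow> hamiltonian_pair 0 v"
  by (auto simp: hamiltonian_pair_def invariants_def d2_left.zero omega_zero d0_def fun_eq_iff)

lemma invariants_central: "invariants act \<subseteq> lie_center (adm_lie br sv act \<omega>)"
  by (auto simp: lie_center_def adm_lie_def lie_on_def invariants_pair admissible_iff
      adm_bracket_left additive_simps)

lemma d_adm_bracket_d0:
  assumes "v \<in> admissible br act \<omega>" and "w \<in> admissible br act \<omega>"
  shows "d_adm_bracket br act \<omega> (d0 act v) (d0 act w) = d0 act (adm_bracket br act \<omega> v w)"
  unfolding d_adm_bracket_def
proof (rule the_equality)
  \<comment> \<open>The bracket of admissible vectors is defined in terms of their differentials.\<close>
  show "\<gamma> = d0 act (adm_bracket br act \<omega> v w)"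
    if "\<exists>v1\<in>admissible br act \<omega>. \<exists>v2\<in>admissible br act \<omega>.
      d0 act v = d0 act v1 \<and> d0 act w = d0 act v2 \<and> \<gamma> = d0 act (adm_bracket br act \<omega> v1 v2)" for \<gamma>
    using that by (auto simp: adm_bracket_def)
qed (use assms in blast)

lemma d0_hom: "lie_hom (adm_lie br sv act \<omega>) (d_adm_lie br sv act \<omega>) (d0 act)"
  by (rule lie_hom_onto_structure[OF lie_algebra_adm])
    (simp_all add: adm_lie_def d_adm_lie_def lie_on_def d_adm_bracket_d0 d0_add d0_scale d0_zero)

lemma d_adm_quotient:
  "\<exists>\<Phi>. lie_iso (lie_quotient (adm_lie br sv act \<omega>) (invariants act)) (d_adm_lie br sv act \<omega>) \<Phi> \<and>
    (\<forall>v\<in>admissible br act \<omega>. \<Phi> (lie_coset (adm_lie br sv act \<omega>) (invariants act) v) = d0 act v)"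
proof -
  have "invariants act =
      {v \<in> lcarrier (adm_lie br sv act \<omega>). d0 act v = lzero (d_adm_lie br sv act \<omega>)}"
    by (auto simp: adm_lie_def d_adm_lie_def lie_on_def admissible_iff invariants_pair)
      (auto simp: hamiltonian_pair_def d2_left.zero omega_zero)
  from lie_first_isomorphism[OF d0_hom _ this] show ?thesis
    by (simp add: adm_lie_def d_adm_lie_def lie_on_def)
qed

lemma d0_bracket:
  assumes "hamiltonian_pair \<xi> v" and "hamiltonian_pair \<eta> w"
  shows "d0 act (adm_bracket br act \<omega> v w) = \<omega> (br \<xi> \<eta>)"
proof -
  have "w \<in> admissible br act \<omega>" using assms(2) by (auto simp: admissible_iff)
  then show ?thesis
    using hamiltonian_pair_bracket[OF assms] adm_bracket_left[OF assms(1)]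
    by (simp add: hamiltonian_pair_def)
qed

section \<open>The radical, its normalizer and the two exact sequences\<close>

lemma rad_iff: "\<xi> \<in> rad br act \<omega> \<longleftrightarrow> d\<omega> \<xi> = 0 \<and> \<omega> \<xi> = 0"
  by (auto simp: rad_def ins_def)

lemma h_omega_iff:
  "\<xi> \<in> h_omega br act \<omega> \<longleftrightarrow> d\<omega> \<xi> = 0 \<and> (\<forall>\<eta>\<in>rad br act \<omega>. br \<xi> \<eta> \<in> rad br act \<omega>)"
  by (auto simp: h_omega_def ins_def)

lemma rad_add: "\<lbrakk>x \<in> rad br act \<omega>; y \<in> rad br act \<omega>\<rbrakk> \<Longrightarrow> x + y \<in> rad br act \<omega>"
  by (simp add: rad_iff d2_add omega_add)

lemma rad_diff: "\<lbrakk>x \<in> rad br act \<omega>; y \<in> rad br act \<omega>\<rbrakk> \<Longrightarrow> x - y \<in> rad br act \<omega>"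
  by (simp add: rad_iff d2_left.diff omega_diff)

lemma rad_scale: "x \<in> rad br act \<omega> \<Longrightarrow> sh c x \<in> rad br act \<omega>"
  by (simp add: rad_iff d2_scale_zero) (simp add: fun_eq_iff omega_scale_left)

lemma rad_zero: "0 \<in> rad br act \<omega>"
  by (simp add: rad_iff d2_left.zero omega_zero)

text \<open>
  For symplectic \<open>\<xi>\<close> and \<open>\<eta>\<close> in the radical, both terms of
  \<open>i\<^bsub>[\<xi>,\<eta>]\<^esub> \<omega> = L\<^sub>\<xi> i\<^sub>\<eta> \<omega> - i\<^sub>\<eta> L\<^sub>\<xi> \<omega>\<close> vanish.
\<close>

lemma sp_subset_h_omega: "sp br act \<omega> \<subseteq> h_omega br act \<omega>"
proof
  fix \<xi> assume "\<xi> \<in> sp br act \<omega>"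
  then have \<xi>: "lie_deriv2 br act \<xi> \<omega> = 0" "d\<omega> \<xi> = 0" by (auto simp: sp_def ins_def)
  show "\<xi> \<in> h_omega br act \<omega>"
    using \<xi> d2_bracket[OF \<xi>(2)] ins_bracket[of \<omega> \<xi>]
    by (auto simp: h_omega_iff rad_iff lie_deriv1_def additive_simps fun_eq_iff)
qed

lemma rad_subset_ham: "rad br act \<omega> \<subseteq> ham br act \<omega>"
proof
  fix \<xi> assume "\<xi> \<in> rad br act \<omega>"
  then have "hamiltonian_pair \<xi> 0" by (simp add: hamiltonian_pair_def rad_iff d0_zero)
  then show "\<xi> \<in> ham br act \<omega>" by (auto simp: ham_iff)
qed

lemma ham_subset_h_omega: "ham br act \<omega> \<subseteq> h_omega br act \<omega>"
  using sp_subset_h_omega by (auto simp: ham_def)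

lemma rad_subset_h_omega: "rad br act \<omega> \<subseteq> h_omega br act \<omega>"
  using rad_subset_ham ham_subset_h_omega by blast

lemma lie_algebra_ham: "lie_algebra (lie_on sh (ham br act \<omega>) br)"
  by (rule lie_algebra_subset[OF lie_h]; simp only: ham_iff)
    (blast intro: hamiltonian_pair_zero hamiltonian_pair_add hamiltonian_pair_scale
      hamiltonian_pair_bracket)+

lemma lie_algebra_rad: "lie_algebra (lie_on sh (rad br act \<omega>) br)"
  using rad_subset_h_omega
  by (intro lie_algebra_subset[OF lie_h] rad_zero rad_add rad_scale) (auto simp: h_omega_iff)

lemma lie_algebra_h_omega: "lie_algebra (lie_on sh (h_omega br act \<omega>) br)"
proof (rule lie_algebra_subset[OF lie_h])
  fix x y assume xy: "x \<in> h_omega br act \<omega>" "y \<in> h_omega br act \<omega>"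
  then show "x + y \<in> h_omega br act \<omega>"
    by (simp add: h_omega_iff d2_add additive_simps rad_add)
  \<comment> \<open>The normalizer of a subspace is closed under brackets, by the Jacobi identity.\<close>
  have "br (br x y) r = br x (br y r) - br y (br x r)" for r
    by (simp add: br_derivation[of x y r])
  with xy show "br x y \<in> h_omega br act \<omega>"
    by (simp add: h_omega_iff d2_bracket rad_diff)
qed (use rad_zero rad_subset_h_omega in
    \<open>auto simp: h_omega_iff br_scale_left d2_scale_zero rad_scale\<close>)

text \<open>
  Two elements of \<open>\<hh>\<^sub>\<omega>\<close> with the same image differ by an element of the radical, which brackets
  with \<open>\<hh>\<^sub>\<omega>\<close> do not leave. This is why \<open>\<hh>\<^sub>\<omega>\<close> is cut out by the normalizer condition.
\<close>

lemma C1_bracket_ins: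
  assumes "\<xi> \<in> h_omega br act \<omega>" and "\<eta> \<in> h_omega br act \<omega>"
  shows "C1_bracket br act \<omega> (\<omega> \<xi>) (\<omega> \<eta>) = \<omega> (br \<xi> \<eta>)"
  unfolding C1_bracket_def
proof (rule the_equality)
  show "\<exists>\<xi>1\<in>h_omega br act \<omega>. \<exists>\<xi>2\<in>h_omega br act \<omega>.
      \<omega> \<xi> = ins \<xi>1 \<omega> \<and> \<omega> \<eta> = ins \<xi>2 \<omega> \<and> \<omega> (br \<xi> \<eta>) = ins (br \<xi>1 \<xi>2) \<omega>"
    using assms by (auto simp: ins_def)
next
  fix \<gamma>
  assume "\<exists>\<xi>1\<in>h_omega br act \<omega>. \<exists>\<xi>2\<in>h_omega br act \<omega>.
      \<omega> \<xi> = ins \<xi>1 \<omega> \<and> \<omega> \<eta> = ins \<xi>2 \<omega> \<and> \<gamma> = ins (br \<xi>1 \<xi>2) \<omega>"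
  then obtain \<xi>1 \<xi>2 where rep: "\<xi>1 \<in> h_omega br act \<omega>" "\<xi>2 \<in> h_omega br act \<omega>"
    "\<omega> \<xi> = \<omega> \<xi>1" "\<omega> \<eta> = \<omega> \<xi>2" and \<gamma>: "\<gamma> = \<omega> (br \<xi>1 \<xi>2)"
    by (auto simp: ins_def)
  have "\<xi>1 - \<xi> \<in> rad br act \<omega>" "\<xi>2 - \<eta> \<in> rad br act \<omega>"
    using assms rep by (auto simp: rad_iff h_omega_iff d2_left.diff omega_diff)
  then have "br \<xi>2 (\<xi>1 - \<xi>) \<in> rad br act \<omega>" "br \<xi> (\<xi>2 - \<eta>) \<in> rad br act \<omega>"
    using assms rep by (auto simp: h_omega_iff)
  then have "\<omega> (br \<xi> (\<xi>2 - \<eta>) - br \<xi>2 (\<xi>1 - \<xi>)) = 0"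
    by (simp add: rad_iff omega_diff)
  moreover have "br \<xi>1 \<xi>2 - br \<xi> \<eta> = br \<xi> (\<xi>2 - \<eta>) - br \<xi>2 (\<xi>1 - \<xi>)"
    by (simp add: additive_simps br_antisym[of \<xi>2])
  ultimately show "\<gamma> = \<omega> (br \<xi> \<eta>)"
    using \<gamma> omega_diff[of "br \<xi>1 \<xi>2" "br \<xi> \<eta>"] by simp
qed

lemma C1_omega_cochains: "C1_omega br act \<omega> \<subseteq> cochains1 sh sv"
proof -
  have "continuous_on UNIV (\<omega> \<xi>)" for \<xi>
  proof -
    have "continuous_on UNIV ((\<lambda>(\<xi>, \<eta>). \<omega> \<xi> \<eta>) \<circ> Pair \<xi>)"
      using cochain by (intro continuous_on_compose continuous_intros)
        (auto simp: cochains2_def intro: continuous_on_subset)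
    then show ?thesis by (simp add: comp_def)
  qed
  then show ?thesis
    using cochain by (auto simp: C1_omega_def cochains1_def cochains2_def ins_def)
qed

lemma i_map_hom: "lie_hom (lie_on sh (h_omega br act \<omega>) br) (C1_lie br sv act \<omega>) (i_map br act \<omega>)"
proof -
  interpret H: lie_algebra "lie_on sh (h_omega br act \<omega>) br" by (fact lie_algebra_h_omega)
  show ?thesis
    using H.zero_closed H.add_closed H.scale_closed H.bracket_closed
    by (intro lie_hom_onto_structure[OF lie_algebra_h_omega])
      (auto simp: C1_lie_def C1_omega_def lie_on_def i_map_def ins_def omega_zero omega_add
        omega_scale C1_bracket_ins)
qed

lemma ins_ham_image: "\<omega> ` ham br act \<omega> = d0 act ` admissible br act \<omega>"
proof
  show "\<omega> ` ham br act \<omega> \<subseteq> d0 act ` admissible br act \<omega>"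
  proof
    fix \<alpha> assume "\<alpha> \<in> \<omega> ` ham br act \<omega>"
    then obtain \<xi> v where "hamiltonian_pair \<xi> v" "\<alpha> = \<omega> \<xi>" by (auto simp: ham_iff)
    then show "\<alpha> \<in> d0 act ` admissible br act \<omega>"
      by (intro image_eqI[of _ _ v]) (auto simp: admissible_iff hamiltonian_pair_def)
  qed
  show "d0 act ` admissible br act \<omega> \<subseteq> \<omega> ` ham br act \<omega>"
    by (auto simp: admissible_def ins_def)
qed

lemma q_map_hom: "lie_hom (lie_on sh (ham br act \<omega>) br) (d_adm_lie br sv act \<omega>) (q_map br act \<omega>)"
proof -
  interpret H: lie_algebra "lie_on sh (ham br act \<omega>) br" by (fact lie_algebra_ham)
  have bracket: "d_adm_bracket br act \<omega> (\<omega> \<xi>) (\<omega> \<eta>) = \<omega> (br \<xi> \<eta>)"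
    if "\<xi> \<in> ham br act \<omega>" "\<eta> \<in> ham br act \<omega>" for \<xi> \<eta>
  proof -
    obtain v w where vw: "hamiltonian_pair \<xi> v" "hamiltonian_pair \<eta> w"
      using \<open>\<xi> \<in> _\<close> \<open>\<eta> \<in> _\<close> by (auto simp: ham_iff)
    then have "\<omega> \<xi> = d0 act v" "\<omega> \<eta> = d0 act w"
      "v \<in> admissible br act \<omega>" "w \<in> admissible br act \<omega>"
      by (auto simp: hamiltonian_pair_def admissible_iff)
    then show ?thesis using d_adm_bracket_d0 d0_bracket[OF vw] by simp
  qed
  show ?thesis
    using H.zero_closed H.add_closed H.scale_closed H.bracket_closed
    by (intro lie_hom_onto_structure[OF lie_algebra_ham])
      (auto simp: d_adm_lie_def lie_on_def q_map_def ins_def omega_zero omega_add omega_scale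
        bracket ins_ham_image)
qed

lemma lie_subalgebra_h:
  assumes "lie_algebra (lie_on sh S br)" and "lie_algebra (lie_on sh T br)" and "S \<subseteq> T"
  shows "lie_subalgebra (lie_on sh S br) (lie_on sh T br)"
  using assms by (auto simp: lie_subalgebra_def lie_hom_def lie_on_def)

lemma rad_ham_exact:
  "lie_short_exact (lie_on sh (rad br act \<omega>) br) (\<lambda>\<xi>. \<xi>)
    (lie_on sh (ham br act \<omega>) br) (q_map br act \<omega>) (d_adm_lie br sv act \<omega>)"
proof -
  have "rad br act \<omega> = {\<xi> \<in> ham br act \<omega>. q_map br act \<omega> \<xi> = 0}"
    using rad_subset_ham
    by (auto simp: q_map_def rad_iff ins_def ham_iff hamiltonian_pair_def)
  moreover have "q_map br act \<omega> ` ham br act \<omega> = d0 act ` admissible br act \<omega>"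
    by (simp add: q_map_def ins_def ins_ham_image)
  ultimately show ?thesis
    using q_map_hom lie_subalgebra_h[OF lie_algebra_rad lie_algebra_ham rad_subset_ham]
    by (simp add: lie_short_exact_def lie_subalgebra_def) (simp add: lie_on_def d_adm_lie_def)
qed

lemma rad_h_omega_exact:
  "lie_short_exact (lie_on sh (rad br act \<omega>) br) (\<lambda>\<xi>. \<xi>)
    (lie_on sh (h_omega br act \<omega>) br) (i_map br act \<omega>) (C1_lie br sv act \<omega>)"
proof -
  have "rad br act \<omega> = {\<xi> \<in> h_omega br act \<omega>. i_map br act \<omega> \<xi> = 0}"
    using rad_subset_h_omega by (auto simp: i_map_def rad_iff ins_def h_omega_iff)
  moreover have "i_map br act \<omega> ` h_omega br act \<omega> = C1_omega br act \<omega>"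
    by (simp add: i_map_def C1_omega_def)
  ultimately show ?thesis
    using i_map_hom lie_subalgebra_h[OF lie_algebra_rad lie_algebra_h_omega rad_subset_h_omega]
    by (simp add: lie_short_exact_def lie_subalgebra_def) (simp add: lie_on_def C1_lie_def)
qed

lemma d0_in_C1_omega: "v \<in> admissible br act \<omega> \<Longrightarrow> d0 act v \<in> C1_omega br act \<omega>"
  using ham_subset_h_omega by (auto simp: C1_omega_def admissible_def)

text \<open>
  Both brackets on \<open>d (V\<^sub>\<omega>)\<close> send \<open>(i\<^sub>\<xi> \<omega>, i\<^sub>\<eta> \<omega>)\<close> to \<open>i\<^bsub>[\<xi>,\<eta>]\<^esub> \<omega>\<close> for hamiltonian \<open>\<xi>\<close> and \<open>\<eta>\<close>.
\<close>

lemma C1_bracket_d0: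
  assumes "v \<in> admissible br act \<omega>" and "w \<in> admissible br act \<omega>"
  shows "C1_bracket br act \<omega> (d0 act v) (d0 act w) = d0 act (adm_bracket br act \<omega> v w)"
proof -
  obtain \<xi> \<eta> where pair: "hamiltonian_pair \<xi> v" "hamiltonian_pair \<eta> w"
    using assms by (auto simp: admissible_iff)
  then have "\<xi> \<in> h_omega br act \<omega>" "\<eta> \<in> h_omega br act \<omega>"
    using ham_subset_h_omega by (auto simp: hamiltonian_pair_iff)
  from C1_bracket_ins[OF this] d0_bracket[OF pair] pair show ?thesis
    by (simp add: hamiltonian_pair_def)
qed

lemma d0_hom_C1: "lie_hom (adm_lie br sv act \<omega>) (C1_lie br sv act \<omega>) (d0 act)"
  using lie_algebra_adm i_map_hom d0_in_C1_omega
  by (auto simp: lie_hom_def) (simp_all add: adm_lie_def C1_lie_def lie_on_def d0_add d0_scale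
      C1_bracket_d0)

lemma d_adm_subalgebra: "lie_subalgebra (d_adm_lie br sv act \<omega>) (C1_lie br sv act \<omega>)"
  using d0_hom i_map_hom d0_in_C1_omega
  by (auto simp: lie_subalgebra_def lie_hom_def)
    (auto simp: d_adm_lie_def C1_lie_def lie_on_def C1_bracket_d0 d_adm_bracket_d0)

end

theorem proposition1p1:
  fixes sh :: "'k::{field, topological_ab_group_add, topological_semigroup_mult}
      \<Rightarrow> 'h::topological_ab_group_add \<Rightarrow> 'h"
    and br :: "'h \<Rightarrow> 'h \<Rightarrow> 'h"
    and sv :: "'k \<Rightarrow> 'v::topological_ab_group_add \<Rightarrow> 'v"
    and act :: "'h \<Rightarrow> 'v \<Rightarrow> 'v"
    and \<omega> :: "'h \<Rightarrow> 'h \<Rightarrow> 'v"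
  assumes "topological_lie_algebra sh br"
    and "topological_lie_module sh br sv act"
    and "\<omega> \<in> cochains2 sh sv"
  shows
    "(lie_algebra (adm_lie br sv act \<omega>) \<and>
      (\<forall>v1 v2. \<forall>\<xi>1\<in>ham br act \<omega>. \<forall>\<xi>2\<in>ham br act \<omega>.
        d0 act v1 = ins \<xi>1 \<omega> \<and> d0 act v2 = ins \<xi>2 \<omega> \<longrightarrow>
          adm_bracket br act \<omega> v1 v2 = act \<xi>1 v2 \<and>
          act \<xi>1 v2 = - act \<xi>2 v1 \<and>
          - act \<xi>2 v1 = - \<omega> \<xi>1 \<xi>2) \<and>
      invariants act \<subseteq> lie_center (adm_lie br sv act \<omega>) \<and>
      (\<exists>\<Phi>. lie_iso (lie_quotient (adm_lie br sv act \<omega>) (invariants act))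
              (d_adm_lie br sv act \<omega>) \<Phi> \<and>
            (\<forall>v\<in>admissible br act \<omega>.
              \<Phi> (lie_coset (adm_lie br sv act \<omega>) (invariants act) v) = d0 act v)) \<and>
      lie_short_exact (lie_on sh (rad br act \<omega>) br) (\<lambda>\<xi>. \<xi>)
        (lie_on sh (ham br act \<omega>) br) (q_map br act \<omega>) (d_adm_lie br sv act \<omega>))
    \<and>
     (sp br act \<omega> \<subseteq> h_omega br act \<omega> \<and>
      C1_omega br act \<omega> \<subseteq> cochains1 sh sv \<and>
      lie_algebra (C1_lie br sv act \<omega>) \<and>
      (\<forall>\<xi>1\<in>h_omega br act \<omega>. \<forall>\<xi>2\<in>h_omega br act \<omega>.
        C1_bracket br act \<omega> (ins \<xi>1 \<omega>) (ins \<xi>2 \<omega>) = ins (br \<xi>1 \<xi>2) \<omega>) \<and>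
      (\<forall>\<alpha>1 \<alpha>2. \<forall>\<xi>1\<in>h_omega br act \<omega>. \<forall>\<xi>2\<in>h_omega br act \<omega>.
        \<alpha>1 = ins \<xi>1 \<omega> \<and> \<alpha>2 = ins \<xi>2 \<omega> \<longrightarrow>
          C1_bracket br act \<omega> \<alpha>1 \<alpha>2 =
            lie_deriv1 br act \<xi>1 \<alpha>2 - ins \<xi>2 (lie_deriv2 br act \<xi>1 \<omega>)) \<and>
      lie_hom (lie_on sh (h_omega br act \<omega>) br) (C1_lie br sv act \<omega>) (i_map br act \<omega>) \<and>
      lie_hom (adm_lie br sv act \<omega>) (C1_lie br sv act \<omega>) (d0 act) \<and>
      lie_short_exact (lie_on sh (rad br act \<omega>) br) (\<lambda>\<xi>. \<xi>)
        (lie_on sh (h_omega br act \<omega>) br) (i_map br act \<omega>) (C1_lie br sv act \<omega>) \<and>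
      lie_subalgebra (lie_on sh (ham br act \<omega>) br) (lie_on sh (h_omega br act \<omega>) br) \<and>
      lie_subalgebra (d_adm_lie br sv act \<omega>) (C1_lie br sv act \<omega>) \<and>
      restrict (i_map br act \<omega>) (ham br act \<omega>) = q_map br act \<omega>)"
proof -
  interpret lie_cochain sh br sv act \<omega>
    using assms by (intro lie_cochain.intro lie_cochain_axioms.intro)
  have pairs: "adm_bracket br act \<omega> v1 v2 = act \<xi>1 v2 \<and> act \<xi>1 v2 = - act \<xi>2 v1 \<and>
      - act \<xi>2 v1 = - \<omega> \<xi>1 \<xi>2"
    if "hamiltonian_pair \<xi>1 v1" "hamiltonian_pair \<xi>2 v2" for \<xi>1 \<xi>2 v1 v2
  proof -
    have "v1 \<in> admissible br act \<omega>" "v2 \<in> admissible br act \<omega>"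
      using that by (auto simp: admissible_iff)
    then show ?thesis
      using that adm_bracket_pair[OF that] adm_bracket_left[of \<xi>1 v1 v2]
        adm_bracket_right[of v1 \<xi>2 v2] by simp
  qed
  have "restrict (i_map br act \<omega>) (ham br act \<omega>) = q_map br act \<omega>"
    using ham_subset_h_omega by (auto simp: i_map_def q_map_def fun_eq_iff restrict_def)
  then show ?thesis
    using lie_algebra_adm pairs invariants_central d_adm_quotient rad_ham_exact
      sp_subset_h_omega C1_omega_cochains i_map_hom d0_hom_C1 rad_h_omega_exact
      lie_subalgebra_h[OF lie_algebra_ham lie_algebra_h_omega ham_subset_h_omega] d_adm_subalgebra
    by (simp add: hamiltonian_pair_iff) (auto simp: lie_hom_def ins_def C1_bracket_ins ins_bracket)
qed

end
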